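(* Fix a constant $\delta>0$. Let $k=k(n)$ satisfy $k=n^{o(1)}$ and $k=\omega(1)$, and let $N(\mathbf L)$ be the number of intercalates in a uniformly random $k\times n$ Latin rectangle $\mathbf L$. Then, as $n\to\infty$, \[\Pr\left[N(\mathbf L)\ge(1+\delta)\frac{k^2}{4}\right]\ge\exp\left(\left(\delta-(1+\delta)\log(1+\delta)-o(1)\right)\frac{k^2}{4}\right).\]
   Context: A $k\times n$ Latin rectangle is a $k\times n$ array, every cell of which is filled with a symbol from $\{1,\dots,n\}$, such that every symbol appears at most once in each row and in each column. An intercalate in it is a pair of rows $i<j$ and a pair of columns $x<y$ such that $L_{i,x}=L_{j,y}$ and $L_{i,y}=L_{j,x}$. Logarithms are natural. *)

theory Defs
  imports "HOL-Probability.Probability" "HOL-Library.Landau_Symbols"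
begin

text \<open>
  Arrays are extensional functions on the cells, so that distinct arrays are distinct
  functions and the set of Latin rectangles is finite.
\<close>

definition latin_rectangles :: "nat \<Rightarrow> nat \<Rightarrow> (nat \<times> nat \<Rightarrow> nat) set" where
  "latin_rectangles k n =
     {L \<in> {1..k} \<times> {1..n} \<rightarrow>\<^sub>E {1..n}.
        (\<forall>i\<in>{1..k}. inj_on (\<lambda>x. L (i, x)) {1..n}) \<and>
        (\<forall>x\<in>{1..n}. inj_on (\<lambda>i. L (i, x)) {1..k})}"

definition intercalates ::
    "nat \<Rightarrow> nat \<Rightarrow> (nat \<times> nat \<Rightarrow> nat) \<Rightarrow> ((nat \<times> nat) \<times> (nat \<times> nat)) set" where
  "intercalates k n L =
     {((i, j), (x, y)) | i j x y.
        i \<in> {1..k} \<and> j \<in> {1..k} \<and> i < j \<and>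
        x \<in> {1..n} \<and> y \<in> {1..n} \<and> x < y \<and>
        L (i, x) = L (j, y) \<and> L (i, y) = L (j, x)}"

definition num_intercalates :: "nat \<Rightarrow> nat \<Rightarrow> (nat \<times> nat \<Rightarrow> nat) \<Rightarrow> nat" where
  "num_intercalates k n L = card (intercalates k n L)"

text \<open>
  Meaningful when \<open>k \<le> n\<close>, where Latin rectangles exist; \<open>pmf_of_set\<close> is unspecified
  on the empty set.
\<close>

definition random_latin_rectangle :: "nat \<Rightarrow> nat \<Rightarrow> (nat \<times> nat \<Rightarrow> nat) pmf" where
  "random_latin_rectangle k n = pmf_of_set (latin_rectangles k n)"

end

theory Submission
  imports Defs
begin

text \<open>
  The proof is a switching argument. Let \<open>a t\<close> be the number of Latin rectangles with exactly
  \<open>t\<close> intercalates. Given rows \<open>i < j\<close> and columns \<open>x, y\<close>, let \<open>v\<close>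
  and \<open>w\<close> be the columns with \<open>L (j, v) = L (i, x)\<close> and
  \<open>L (i, w) = L (j, x)\<close>. Swapping the entries of columns \<open>y, v\<close> in row \<open>j\<close>
  and of columns \<open>y, w\<close> in row \<open>i\<close> turns rows \<open>i, j\<close> and columns
  \<open>x, y\<close> into an intercalate. For all but \<open>O(t)\<close> columns \<open>x\<close>, and then all
  but \<open>O(t + k)\<close> columns \<open>y\<close>, the result is a Latin rectangle and no other
  intercalate appears or disappears. The switch is undone by specifying an ordered intercalate
  and \<open>v, w\<close>, so with \<open>\<lambda> = k\<^sup>2 / 4\<close> double counting gives
  \<open>(t + 1) a (t + 1) \<ge> (1 - o(1)) \<lambda> a t\<close> for \<open>t < M\<close>, where
  \<open>M\<close> is \<open>(1 + \<delta>) \<lambda>\<close> rounded up.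

  Iterating, \<open>a t \<le> a M (M! / c ^ M) (c ^ t / t!)\<close> with \<open>c = (1 - o(1)) \<lambda>\<close>.
  As the sum of \<open>c ^ t / t!\<close> is at most \<open>e ^ c\<close>, the event has probability at least
  \<open>c ^ M / (2 M! e ^ c)\<close>, the Poisson weight up to a constant. No information
  about the typical number of intercalates is needed.
\<close>

section \<open>Intercalates, row switches and the existence of Latin rectangles\<close>

text \<open>In contrast to \<open>intercalates\<close>, rows and columns come in either order, so
  that arguments may exchange the two rows or the two columns.\<close>

definition is_intercalate :: "(nat \<times> nat \<Rightarrow> nat) \<Rightarrow> nat \<Rightarrow> nat \<Rightarrow> nat \<Rightarrow> nat \<Rightarrow> bool" where
  "is_intercalate L r s c d \<longleftrightarrow> r \<noteq> s \<and> c \<noteq> d \<and> L (r, c) = L (s, d) \<and> L (r, d) = L (s, c)"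

lemma is_intercalate_row_commute: "is_intercalate L r s c d \<Longrightarrow> is_intercalate L s r c d"
  by (auto simp: is_intercalate_def)

lemma is_intercalate_col_commute: "is_intercalate L r s c d \<Longrightarrow> is_intercalate L r s d c"
  by (auto simp: is_intercalate_def)

text \<open>The columns \<open>v\<close> and \<open>w\<close> are arguments and are not computed
  from \<open>L\<close>: for fixed arguments the map is an involution, so a switch can be undone
  from the resulting array and \<open>i\<close>, \<open>j\<close>, \<open>y\<close>,
  \<open>v\<close>, \<open>w\<close>.\<close>

definition row_switch ::
    "nat \<Rightarrow> nat \<Rightarrow> nat \<Rightarrow> nat \<Rightarrow> nat \<Rightarrow> (nat \<times> nat \<Rightarrow> nat) \<Rightarrow> nat \<times> nat \<Rightarrow> nat" where
  "row_switch i j y v w L = (\<lambda>(r, c).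
     if r = j then L (j, Transposition.transpose y v c)
     else if r = i then L (i, Transposition.transpose y w c)
     else L (r, c))"

lemma row_switch_involutory [simp]: "row_switch i j y v w (row_switch i j y v w L) = L"
  by (auto simp: row_switch_def fun_eq_iff)

lemma row_switch_commute: "i \<noteq> j \<Longrightarrow> row_switch i j y v w L = row_switch j i y w v L"
  by (auto simp: row_switch_def fun_eq_iff)

lemma intercalates_altdef:
  "intercalates k n L = {((i, j), (x, y)) | i j x y.
     i \<in> {1..k} \<and> j \<in> {1..k} \<and> i < j \<and> x \<in> {1..n} \<and> y \<in> {1..n} \<and> x < y \<and>
     is_intercalate L i j x y}"
  by (auto simp: intercalates_def is_intercalate_def)

lemma finite_intercalates: "finite (intercalates k n L)"
  by (rule finite_subset[of _ "({1..k} \<times> {1..k}) \<times> ({1..n} \<times> {1..n})"])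
    (auto simp: intercalates_def)

lemma finite_latin_rectangles: "finite (latin_rectangles k n)"
  by (rule finite_subset[of _ "{1..k} \<times> {1..n} \<rightarrow>\<^sub>E {1..n}"])
    (auto simp: latin_rectangles_def intro!: finite_PiE)

lemma latin_rectangles_nonempty:
  assumes "k \<le> n"
  shows "latin_rectangles k n \<noteq> {}"
proof -
  \<comment> \<open>The cyclic rectangle: row plus column modulo \<open>n\<close>, with residues in
    \<open>{1..n}\<close>. Its columns have no repetition because \<open>k \<le> n\<close>.\<close>
  define L where "L = (\<lambda>p\<in>{1..k} \<times> {1..n}.
    if fst p + snd p \<le> n then fst p + snd p else fst p + snd p - n)"
  have "L \<in> latin_rectangles k n"
    using assms unfolding latin_rectangles_def L_def
    by (auto simp: inj_on_def split: if_splits)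
  then show ?thesis by blast
qed

lemma card_Un3_le: "card (A \<union> (B \<union> C)) \<le> card A + (card B + card C)"
  by (rule order.trans[OF card_Un_le]) (rule add_left_mono[OF card_Un_le])

section \<open>Columns, partners and the number of admissible switches\<close>

locale latin_rectangle =
  fixes k n :: nat and L :: "nat \<times> nat \<Rightarrow> nat"
  assumes latin: "L \<in> latin_rectangles k n"
begin

lemma row_inj: "\<lbrakk>L (r, x) = L (r, y); r \<in> {1..k}; x \<in> {1..n}; y \<in> {1..n}\<rbrakk> \<Longrightarrow> x = y"
  using latin unfolding latin_rectangles_def inj_on_def by blast

lemma col_inj: "\<lbrakk>L (r, x) = L (s, x); r \<in> {1..k}; s \<in> {1..k}; x \<in> {1..n}\<rbrakk> \<Longrightarrow> r = s"
  using latin unfolding latin_rectangles_def inj_on_def by blast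

lemma entry_mem: "\<lbrakk>r \<in> {1..k}; x \<in> {1..n}\<rbrakk> \<Longrightarrow> L (r, x) \<in> {1..n}"
  using latin unfolding latin_rectangles_def PiE_def Pi_def by blast

lemma row_surj: "r \<in> {1..k} \<Longrightarrow> (\<lambda>x. L (r, x)) ` {1..n} = {1..n}"
  by (rule card_subset_eq) (auto simp: entry_mem[simplified] card_image row_inj[simplified] inj_on_def)

definition col :: "nat \<Rightarrow> nat \<Rightarrow> nat" where
  "col r s = inv_into {1..n} (\<lambda>x. L (r, x)) s"

lemma col_mem: "\<lbrakk>r \<in> {1..k}; s \<in> {1..n}\<rbrakk> \<Longrightarrow> col r s \<in> {1..n}"
  unfolding col_def using row_surj by (metis inv_into_into)

lemma entry_col: "\<lbrakk>r \<in> {1..k}; s \<in> {1..n}\<rbrakk> \<Longrightarrow> L (r, col r s) = s"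
  unfolding col_def using row_surj by (metis (mono_tags, lifting) f_inv_into_f)

lemma col_eqI: "\<lbrakk>L (r, x) = s; r \<in> {1..k}; x \<in> {1..n}\<rbrakk> \<Longrightarrow> col r s = x"
  by (metis entry_col entry_mem col_mem row_inj)

text \<open>A switch changes cells only in columns \<open>y\<close>, \<open>v\<close> and
  \<open>w\<close>. Keeping these outside \<open>touched\<close> ensures that no old intercalate is
  destroyed.\<close>

definition touched :: "nat set" where
  "touched = {x. \<exists>y r s. x \<in> {1..n} \<and> y \<in> {1..n} \<and> r \<in> {1..k} \<and> s \<in> {1..k} \<and>
     is_intercalate L r s x y}"

lemma touchedI:
  "\<lbrakk>is_intercalate L r s x y; x \<in> {1..n}; y \<in> {1..n}; r \<in> {1..k}; s \<in> {1..k}\<rbrakk> \<Longrightarrow>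
    x \<in> touched \<and> y \<in> touched"
  unfolding touched_def using is_intercalate_col_commute by blast

lemma intercalates_touched:
  "((r, s), (x, y)) \<in> intercalates k n L \<Longrightarrow> x \<in> touched \<and> y \<in> touched"
  unfolding intercalates_altdef using touchedI by blast

text \<open>Every intercalate contributes two columns; sorting a witness by \<open>min\<close> and
  \<open>max\<close> turns it into a member of \<open>intercalates\<close>.\<close>

lemma card_touched: "finite touched" "card touched \<le> 2 * num_intercalates k n L"
proof -
  let ?I = "intercalates k n L"
  have sub: "touched \<subseteq> (\<lambda>p. fst (snd p)) ` ?I \<union> (\<lambda>p. snd (snd p)) ` ?I"
  proof
    fix x assume "x \<in> touched"
    then obtain y r s where *: "x \<in> {1..n}" "y \<in> {1..n}" "r \<in> {1..k}" "s \<in> {1..k}"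
        "is_intercalate L r s x y"
      unfolding touched_def by blast
    have ne: "r \<noteq> s" "x \<noteq> y" using *(5) by (auto simp: is_intercalate_def)
    have "is_intercalate L (min r s) (max r s) (min x y) (max x y)"
      using *(5) by (auto simp: min_def max_def is_intercalate_def)
    then have "((min r s, max r s), (min x y, max x y)) \<in> ?I"
      unfolding intercalates_altdef using * ne by (auto simp: min_def max_def)
    then show "x \<in> (\<lambda>p. fst (snd p)) ` ?I \<union> (\<lambda>p. snd (snd p)) ` ?I"
      by (force simp: min_def max_def split: if_splits)
  qed
  have fin: "finite ((\<lambda>p. fst (snd p)) ` ?I \<union> (\<lambda>p. snd (snd p)) ` ?I)"
    using finite_intercalates by blast
  show "finite touched" using sub fin finite_subset by blast
  have "card touched \<le> card ((\<lambda>p. fst (snd p)) ` ?I \<union> (\<lambda>p. snd (snd p)) ` ?I)"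
    by (rule card_mono[OF fin sub])
  also have "\<dots> \<le> card ((\<lambda>p. fst (snd p)) ` ?I) + card ((\<lambda>p. snd (snd p)) ` ?I)"
    by (rule card_Un_le)
  also have "\<dots> \<le> card ?I + card ?I"
    by (intro add_mono card_image_le finite_intercalates)
  finally show "card touched \<le> 2 * num_intercalates k n L"
    by (simp add: num_intercalates_def)
qed

text \<open>The switch uses \<open>partner i j x\<close> as \<open>v\<close> and
  \<open>partner j i x\<close> as \<open>w\<close>.\<close>

definition partner :: "nat \<Rightarrow> nat \<Rightarrow> nat \<Rightarrow> nat" where
  "partner i j x = col j (L (i, x))"

lemma partner_mem: "\<lbrakk>i \<in> {1..k}; j \<in> {1..k}; x \<in> {1..n}\<rbrakk> \<Longrightarrow> partner i j x \<in> {1..n}"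
  unfolding partner_def by (intro col_mem entry_mem)

lemma entry_partner: "\<lbrakk>i \<in> {1..k}; j \<in> {1..k}; x \<in> {1..n}\<rbrakk> \<Longrightarrow> L (j, partner i j x) = L (i, x)"
  unfolding partner_def by (intro entry_col entry_mem)

text \<open>Serves to bound the columns \<open>x\<close> with a touched partner by the number of
  touched columns.\<close>

lemma inj_on_partner:
  assumes "i \<in> {1..k}" "j \<in> {1..k}"
  shows "inj_on (partner i j) {1..n}"
proof (rule inj_onI)
  fix x y assume *: "x \<in> {1..n}" "y \<in> {1..n}" "partner i j x = partner i j y"
  then have "L (i, x) = L (i, y)" by (metis assms entry_partner)
  then show "x = y" using assms * row_inj by blast
qed

text \<open>
  The first two clauses keep columns \<open>y\<close> and \<open>partner i j x\<close> free of repetitions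
  after the switch; the last two rule out a second new intercalate through either of these
  columns, between row \<open>j\<close> and another row \<open>r\<close>. The clauses for row \<open>i\<close> are
  those of \<open>avoids j i x y\<close>. Every clause excludes one \<open>y\<close> for each \<open>r\<close>.
\<close>

definition avoids :: "nat \<Rightarrow> nat \<Rightarrow> nat \<Rightarrow> nat \<Rightarrow> bool" where
  "avoids i j x y \<longleftrightarrow> (\<forall>r\<in>{1..k}.
     L (r, y) \<noteq> L (i, x) \<and>
     L (j, y) \<noteq> L (r, partner i j x) \<and>
     L (r, y) \<noteq> L (j, col r (L (i, x))) \<and>
     L (j, y) \<noteq> L (r, col j (L (r, partner i j x))))"

definition switchable :: "nat \<Rightarrow> nat \<Rightarrow> nat \<Rightarrow> nat \<Rightarrow> bool" where
  "switchable i j x y \<longleftrightarrow> x \<in> {1..n} \<and> y \<in> {1..n} \<and>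
     x \<notin> touched \<and> y \<notin> touched \<and> partner i j x \<notin> touched \<and> partner j i x \<notin> touched \<and>
     avoids i j x y \<and> avoids j i x y"

lemma switchable_commute: "switchable i j x y \<Longrightarrow> switchable j i x y"
  unfolding switchable_def by blast

text \<open>For each \<open>r\<close> the symbol \<open>g r\<close> occurs at most once in row
  \<open>f r\<close>, namely in column \<open>col (f r) (g r)\<close>.\<close>

lemma card_solutions_le:
  assumes "\<And>r. r \<in> {1..k} \<Longrightarrow> f r \<in> {1..k}"
  shows "card {y \<in> {1..n}. \<exists>r\<in>{1..k}. L (f r, y) = g r} \<le> k"
proof -
  have "{y \<in> {1..n}. \<exists>r\<in>{1..k}. L (f r, y) = g r} \<subseteq> (\<lambda>r. col (f r) (g r)) ` {1..k}"
    using assms col_eqI by (smt (verit, best) image_iff mem_Collect_eq subsetI)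
  then have "card {y \<in> {1..n}. \<exists>r\<in>{1..k}. L (f r, y) = g r} \<le> card {1..k}"
    by (meson card_image_le card_mono finite_atLeastAtMost finite_imageI le_trans)
  then show ?thesis by simp
qed

lemma card_not_avoids:
  assumes "j \<in> {1..k}"
  shows "card {y \<in> {1..n}. \<not> avoids i j x y} \<le> 4 * k"
proof -
  define S where "S f g = {y \<in> {1..n}. \<exists>r\<in>{1..k}. L (f r, y) = g r}" for f g
  let ?A = "S (\<lambda>r. r) (\<lambda>r. L (i, x))"
  let ?B = "S (\<lambda>r. j) (\<lambda>r. L (r, partner i j x))"
  let ?C = "S (\<lambda>r. r) (\<lambda>r. L (j, col r (L (i, x))))"
  let ?D = "S (\<lambda>r. j) (\<lambda>r. L (r, col j (L (r, partner i j x))))"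
  have "{y \<in> {1..n}. \<not> avoids i j x y} = ?A \<union> ?B \<union> (?C \<union> ?D)"
    unfolding avoids_def S_def by blast
  moreover have "card (S f g) \<le> k" if "\<And>r. r \<in> {1..k} \<Longrightarrow> f r \<in> {1..k}" for f g
    unfolding S_def using that by (rule card_solutions_le)
  then have "card ?A \<le> k" "card ?B \<le> k" "card ?C \<le> k" "card ?D \<le> k"
    using assms by auto
  moreover have "card (?A \<union> ?B \<union> (?C \<union> ?D)) \<le> card ?A + card ?B + (card ?C + card ?D)"
    by (meson add_mono card_Un_le le_trans)
  ultimately show ?thesis by simp
qed

text \<open>The column \<open>x\<close> and its two partners must be untouched, which excludes at
  most \<open>2 * t\<close> choices of \<open>x\<close> each. For such an \<open>x\<close>, at most
  \<open>2 * t\<close> choices of \<open>y\<close> are touched and each of the two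
  \<open>avoids\<close> conditions excludes at most \<open>4 * k\<close>. Truncated subtraction
  makes the bound trivial when too few columns remain.\<close>

lemma card_switchable:
  assumes "i \<in> {1..k}" "j \<in> {1..k}" and t: "num_intercalates k n L = t"
  shows "card {(x, y). switchable i j x y} \<ge> (n - 6 * t) * (n - (2 * t + 8 * k))"
proof -
  let ?T = touched
  let ?bad = "\<lambda>f. {x \<in> {1..n}. f x \<in> ?T}"
  define X where "X = {x \<in> {1..n}. x \<notin> ?T \<and> partner i j x \<notin> ?T \<and> partner j i x \<notin> ?T}"
  have T: "finite ?T" "card ?T \<le> 2 * t" using card_touched t by auto
  have "card (?bad f) \<le> 2 * t" if "inj_on f {1..n}" for f
  proof -
    have "card (?bad f) \<le> card ?T"
    proof (rule card_inj_on_le)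
      show "inj_on f (?bad f)" by (rule inj_on_subset[OF that]) auto
    qed (use T in auto)
    then show ?thesis using T by simp
  qed
  note bad = this
  have "card ({1..n} - X) \<le> 6 * t"
  proof -
    have eq: "{1..n} - X = ?bad id \<union> (?bad (partner i j) \<union> ?bad (partner j i))"
      unfolding X_def by auto
    have "card ({1..n} - X) \<le>
        card (?bad id) + (card (?bad (partner i j)) + card (?bad (partner j i)))"
      unfolding eq by (rule card_Un3_le)
    also have "\<dots> \<le> 2 * t + (2 * t + 2 * t)"
      by (rule add_mono[OF bad[OF inj_on_id]
          add_mono[OF bad[OF inj_on_partner] bad[OF inj_on_partner]]]) (fact assms(1,2))+
    finally show ?thesis by simp
  qed
  moreover have "card ({1..n} - X) = n - card X"
    by (subst card_Diff_subset) (auto simp: X_def)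
  ultimately have X: "n - 6 * t \<le> card X" by linarith
  have Y: "n - (2 * t + 8 * k) \<le> card {y. switchable i j x y}" if "x \<in> X" for x
  proof -
    let ?Y = "{y. switchable i j x y}"
    have eq: "{1..n} - ?Y =
        ?bad id \<union> ({y \<in> {1..n}. \<not> avoids i j x y} \<union> {y \<in> {1..n}. \<not> avoids j i x y})"
      using that unfolding X_def switchable_def by auto
    have "card ({1..n} - ?Y) \<le> card (?bad id) +
        (card {y \<in> {1..n}. \<not> avoids i j x y} + card {y \<in> {1..n}. \<not> avoids j i x y})"
      unfolding eq by (rule card_Un3_le)
    also have "\<dots> \<le> 2 * t + (4 * k + 4 * k)"
      by (rule add_mono[OF bad[OF inj_on_id] add_mono[OF card_not_avoids card_not_avoids]])
        (fact assms(1,2))+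
    finally have "card ({1..n} - ?Y) \<le> 2 * t + 8 * k" by simp
    moreover have "?Y \<subseteq> {1..n}" by (auto simp: switchable_def)
    then have "card ({1..n} - ?Y) = n - card ?Y"
      by (subst card_Diff_subset) (auto intro: finite_subset)
    ultimately show ?thesis by linarith
  qed
  have "{(x, y). switchable i j x y} = Sigma X (\<lambda>x. {y. switchable i j x y})"
    unfolding X_def switchable_def by auto
  moreover have "finite X" by (auto simp: X_def)
  moreover have "finite {y. switchable i j x y}" for x
    by (rule finite_subset[of _ "{1..n}"]) (auto simp: switchable_def)
  ultimately have "card {(x, y). switchable i j x y} = (\<Sum>x\<in>X. card {y. switchable i j x y})"
    by (simp add: card_SigmaI)
  also have "\<dots> \<ge> card X * (n - (2 * t + 8 * k))"
    using sum_mono[of X "\<lambda>_. n - (2 * t + 8 * k)"] Y by simp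
  finally show ?thesis using X by (meson le_trans mult_le_mono1)
qed

end


section \<open>A switch preserves the Latin property and adds exactly one intercalate\<close>

locale switching = latin_rectangle +
  fixes i j x y :: nat
  assumes i: "i \<in> {1..k}" and j: "j \<in> {1..k}" and ij: "i \<noteq> j"
    and switchable: "switchable i j x y"
begin

abbreviation "v \<equiv> partner i j x"
abbreviation "w \<equiv> partner j i x"
abbreviation "L' \<equiv> row_switch i j y v w L"

lemma mem: "x \<in> {1..n}" "y \<in> {1..n}" "v \<in> {1..n}" "w \<in> {1..n}"
  using switchable i j partner_mem unfolding switchable_def by blast+

lemma entry_v: "L (j, v) = L (i, x)" and entry_w: "L (i, w) = L (j, x)"
  using entry_partner i j mem by blast+

lemma clean: "x \<notin> touched" "y \<notin> touched" "v \<notin> touched" "w \<notin> touched"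
  using switchable unfolding switchable_def by blast+

lemma avoid_entry: "r \<in> {1..k} \<Longrightarrow> L (r, y) \<noteq> L (i, x)"
  and avoid_col_v: "r \<in> {1..k} \<Longrightarrow> L (j, y) \<noteq> L (r, v)"
  and avoid_y: "r \<in> {1..k} \<Longrightarrow> L (r, y) \<noteq> L (j, col r (L (i, x)))"
  and avoid_v: "r \<in> {1..k} \<Longrightarrow> L (j, y) \<noteq> L (r, col j (L (r, v)))"
  using switchable unfolding switchable_def avoids_def by blast+

text \<open>Exchanging \<open>i\<close> and \<open>j\<close> exchanges \<open>v\<close> and
  \<open>w\<close> and gives the same switched array, so facts about row \<open>j\<close> transfer
  to row \<open>i\<close>. For this the locale assumes \<open>i \<noteq> j\<close> and not
  \<open>i < j\<close>.\<close>

lemma sym: "switching k n L j i x y"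
  using i j ij switchable switchable_commute by unfold_locales auto

lemma sym_switch: "row_switch j i y w v L = L'"
  using ij row_switch_commute by metis

lemma avoid_entry': "r \<in> {1..k} \<Longrightarrow> L (r, y) \<noteq> L (j, x)"
  by (rule switching.avoid_entry[OF sym])

lemma distinct: "x \<noteq> y" "x \<noteq> v" "x \<noteq> w" "y \<noteq> v" "y \<noteq> w" "v \<noteq> w"
proof -
  show "x \<noteq> y" using avoid_entry[OF i] by auto
  show "x \<noteq> v" using entry_v col_inj[OF _ j i mem(1)] ij by metis
  \<comment> \<open>If \<open>v = w\<close>, rows \<open>i\<close>, \<open>j\<close> and columns
    \<open>x\<close>, \<open>v\<close> would already form an intercalate, but \<open>x\<close> is
    untouched.\<close>
  then have "\<not> is_intercalate L i j x v"
    using clean touchedI[OF _ mem(1,3) i j] by blast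
  then show "v \<noteq> w" using \<open>x \<noteq> v\<close> entry_v entry_w ij unfolding is_intercalate_def by metis
  show "x \<noteq> w" using entry_w col_inj[OF _ i j mem(1)] ij by metis
  show "y \<noteq> v" using entry_v avoid_entry[OF j] by auto
  show "y \<noteq> w" using entry_w avoid_entry'[OF i] by auto
qed

lemma switch_entries:
  "L' (j, y) = L (i, x)" "L' (j, v) = L (j, y)" "L' (i, y) = L (j, x)" "L' (i, w) = L (i, y)"
  "c \<noteq> y \<Longrightarrow> c \<noteq> v \<Longrightarrow> L' (j, c) = L (j, c)"
  "c \<noteq> y \<Longrightarrow> c \<noteq> w \<Longrightarrow> L' (i, c) = L (i, c)"
  "r \<noteq> i \<Longrightarrow> r \<noteq> j \<Longrightarrow> L' (r, c) = L (r, c)"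
  using ij entry_v entry_w by (auto simp: row_switch_def transpose_apply_other)

text \<open>Row \<open>j\<close> changes only in column \<open>y\<close>, where it receives
  \<open>L (i, x)\<close>, and in column \<open>v\<close>, where it receives
  \<open>L (j, y)\<close>; the first two clauses of \<open>avoids\<close> exclude these symbols from
  the respective columns.\<close>

lemma switch_col_j:
  assumes c: "c \<in> {1..n}" and s: "s \<in> {1..k}" "s \<noteq> i" "s \<noteq> j"
  shows "L' (j, c) \<noteq> L (s, c)"
proof -
  consider "c = y" | "c = v" | "c \<noteq> y" "c \<noteq> v" by blast
  then show ?thesis
  proof cases
    case 1
    then show ?thesis using switch_entries(1) avoid_entry[OF s(1)] by auto
  next
    case 2
    then show ?thesis using switch_entries(2) avoid_col_v[OF s(1)] by auto
  next
    case 3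
    then show ?thesis using switch_entries(5)[OF 3] col_inj[OF _ j s(1) c] s by auto
  qed
qed

lemma switch_latin: "L' \<in> latin_rectangles k n"
proof -
  have tr: "bij_betw (Transposition.transpose y u) {1..n} {1..n}" if "u \<in> {1..n}" for u
    using that mem by (intro bij_betw_byWitness[where f' = "Transposition.transpose y u"])
      (auto simp: Transposition.transpose_def)
  \<comment> \<open>Each row of \<open>L'\<close> is a row of \<open>L\<close> with its columns
    permuted. As the permutation fixes all columns outside \<open>{1..n}\<close>, \<open>L'\<close>
    remains extensional.\<close>
  have rows: "\<exists>\<pi>. bij_betw \<pi> {1..n} {1..n} \<and> (\<forall>c. c \<notin> {1..n} \<longrightarrow> \<pi> c = c) \<and>
      (\<forall>c. L' (r, c) = L (r, \<pi> c))" for r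
  proof -
    consider "r = j" | "r = i" "r \<noteq> j" | "r \<noteq> i" "r \<noteq> j" by blast
    then show ?thesis
    proof cases
      case 1
      then show ?thesis using tr[OF mem(3)] mem
        by (intro exI[of _ "Transposition.transpose y v"])
          (auto simp: row_switch_def Transposition.transpose_def)
    next
      case 2
      then show ?thesis using tr[OF mem(4)] mem
        by (intro exI[of _ "Transposition.transpose y w"])
          (auto simp: row_switch_def Transposition.transpose_def)
    next
      case 3
      then show ?thesis by (intro exI[of _ id]) (auto simp: switch_entries)
    qed
  qed
  have "L' \<in> {1..k} \<times> {1..n} \<rightarrow>\<^sub>E {1..n}"
  proof (rule PiE_I)
    fix p assume "p \<in> {1..k} \<times> {1..n}"
    then obtain r c where p: "p = (r, c)" "r \<in> {1..k}" "c \<in> {1..n}" by blast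
    obtain \<pi> where "bij_betw \<pi> {1..n} {1..n}" "\<forall>c. L' (r, c) = L (r, \<pi> c)" using rows by blast
    then show "L' p \<in> {1..n}" using p entry_mem bij_betwE by metis
  next
    fix p assume p: "p \<notin> {1..k} \<times> {1..n}"
    obtain r c where rc: "p = (r, c)" by fastforce
    obtain \<pi> where \<pi>: "bij_betw \<pi> {1..n} {1..n}" "\<forall>c. c \<notin> {1..n} \<longrightarrow> \<pi> c = c"
      "\<forall>c. L' (r, c) = L (r, \<pi> c)" using rows by blast
    have "(r, \<pi> c) \<notin> {1..k} \<times> {1..n}"
      using p rc \<pi>(2) bij_betwE[OF \<pi>(1)] by (cases "c \<in> {1..n}") auto
    moreover have "L q = undefined" if "q \<notin> {1..k} \<times> {1..n}" for q
      using latin that unfolding latin_rectangles_def by (blast intro: PiE_arb)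
    ultimately show "L' p = undefined" using \<pi>(3) rc by metis
  qed
  moreover have "inj_on (\<lambda>c. L' (r, c)) {1..n}" if "r \<in> {1..k}" for r
  proof -
    obtain \<pi> where \<pi>: "bij_betw \<pi> {1..n} {1..n}" "\<forall>c. L' (r, c) = L (r, \<pi> c)" using rows by blast
    have "inj_on (\<lambda>c. L (r, c)) {1..n}" using row_inj that by (auto intro: inj_onI)
    then have "inj_on ((\<lambda>c. L (r, c)) \<circ> \<pi>) {1..n}"
      using \<pi>(1) unfolding bij_betw_def by (intro comp_inj_on) auto
    then show ?thesis using \<pi>(2) by (simp add: comp_def)
  qed
  moreover have "inj_on (\<lambda>r. L' (r, c)) {1..k}" if c: "c \<in> {1..n}" for c
  proof -
    have ij': "L' (i, c) \<noteq> L' (j, c)"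
    proof -
      consider "c = y" | "c = v" | "c = w" | "c \<noteq> y" "c \<noteq> v" "c \<noteq> w" by blast
      then show ?thesis
      proof cases
        case 1
        then show ?thesis using switch_entries(1,3) distinct(1) ij col_inj[OF _ i j mem(1)] by auto
      next
        case 2
        then show ?thesis
          using switch_entries(2) switch_entries(6)[of v] distinct avoid_col_v[OF i] by auto
      next
        case 3
        then show ?thesis
          using switch_entries(4) switch_entries(5)[of w] distinct
            switching.avoid_col_v[OF sym j] by auto
      next
        case 4
        then show ?thesis using switch_entries(5,6) ij col_inj[OF _ i j c] by auto
      qed
    qed
    \<comment> \<open>With \<open>s\<close> unchanged, the cases \<open>r = j\<close> and
      \<open>r = i\<close> are \<open>switch_col_j\<close> and its mirror image. A repetition could
      then only be between rows \<open>i\<close> and \<open>j\<close>, which \<open>ij'\<close>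
      excludes.\<close>
    have other: "L' (r, c) \<noteq> L' (s, c)"
      if "r \<in> {1..k}" "s \<in> {1..k}" "r \<noteq> s" "s \<noteq> i" "s \<noteq> j" for r s
    proof (cases "r = j")
      case True
      then show ?thesis
        using switch_col_j[OF c that(2,4,5)] switch_entries(7)[OF that(4,5)] by simp
    next
      case rj: False
      show ?thesis
      proof (cases "r = i")
        case True
        then show ?thesis
          using switching.switch_col_j[OF sym c that(2,5,4)] switch_entries(7)[OF that(4,5)]
            sym_switch by simp
      next
        case False
        then show ?thesis
          using switch_entries(7)[OF False rj] switch_entries(7)[OF that(4,5)] that
            col_inj[OF _ that(1,2) c] by auto
      qed
    qed
    show ?thesis
    proof (rule inj_onI, rule ccontr)
      fix r s assume rs: "r \<in> {1..k}" "s \<in> {1..k}" "L' (r, c) = L' (s, c)" "r \<noteq> s"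
      then have "s = i \<or> s = j" "r = i \<or> r = j" using other[of r s] other[of s r] by auto
      then show False using rs ij' by auto
    qed
  qed
  ultimately show ?thesis unfolding latin_rectangles_def by blast
qed

lemma switch_intercalate_unchanged:
  assumes "is_intercalate L r s c d" "c \<in> {1..n}" "d \<in> {1..n}" "r \<in> {1..k}" "s \<in> {1..k}"
  shows "is_intercalate L' r s c d"
proof -
  have "c \<in> touched" "d \<in> touched" using touchedI[OF assms] by blast+
  then have "L' (r, c) = L (r, c)" "L' (s, c) = L (s, c)" "L' (r, d) = L (r, d)" "L' (s, d) = L (s, d)"
    using clean switch_entries(5-7) by metis+
  then show ?thesis using assms(1) by (simp add: is_intercalate_def)
qed

text \<open>Row \<open>s\<close> is unchanged, and column \<open>d\<close> is neither
  \<open>y\<close> nor \<open>v\<close>, since otherwise \<open>L (i, x)\<close> would repeat in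
  column \<open>v\<close> of \<open>L\<close>. The two old entries in column \<open>d\<close> then
  determine \<open>d\<close> and violate the third clause of \<open>avoids\<close> if
  \<open>c = y\<close>, the fourth if \<open>c = v\<close>.\<close>

lemma no_intercalate_row_j:
  assumes ic: "is_intercalate L' j s c d" and mem': "c \<in> {1..n}" "d \<in> {1..n}" "s \<in> {1..k}"
    and s: "s \<noteq> i" and c: "c = y \<or> c = v"
  shows False
proof -
  have sj: "s \<noteq> j" using ic by (auto simp: is_intercalate_def)
  have e: "L' (j, c) = L (s, d)" "L' (j, d) = L (s, c)" and cd: "c \<noteq> d"
    using ic switch_entries(7)[OF s sj] unfolding is_intercalate_def by auto
  have "\<not> (c = y \<and> d = v)" "\<not> (c = v \<and> d = y)"
    using e switch_entries(1) entry_v col_inj[OF _ mem'(3) j mem(3)] sj by metis+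
  then have Ld: "L (j, d) = L (s, c)"
    using c cd e(2) switch_entries(5)[of d] by auto
  show False
  proof (cases "c = y")
    case True
    then have "col s (L (i, x)) = d"
      using e(1) switch_entries(1) by (intro col_eqI mem') auto
    then show False using avoid_y[OF mem'(3)] Ld True by auto
  next
    case False
    then have cv: "c = v" using c by blast
    have "col j (L (s, v)) = d" using Ld cv by (intro col_eqI j mem') auto
    then show False using avoid_v[OF mem'(3)] e(1) switch_entries(2) cv by auto
  qed
qed

text \<open>Row \<open>i\<close> now has \<open>L (j, x)\<close> in column \<open>y\<close>, and row
  \<open>j\<close> of \<open>L'\<close> has this symbol in column \<open>x\<close> only.\<close>

lemma intercalate_rows_ij:
  assumes ic: "is_intercalate L' i j c d" and mem': "c \<in> {1..n}" "d \<in> {1..n}" "c = y"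
  shows "d = x"
proof -
  have "L' (j, d) = L' (j, x)"
    using ic mem'(3) switch_entries(3,5) distinct unfolding is_intercalate_def by metis
  then show ?thesis
    using latin_rectangle.row_inj[OF latin_rectangle.intro[OF switch_latin] _ j mem'(2) mem(1)]
    by blast
qed

text \<open>Both rows change here, but \<open>d\<close> turns out to differ from \<open>y\<close>,
  \<open>v\<close> and \<open>w\<close>, so its entries are old and the fourth clause of
  \<open>avoids\<close> applies with \<open>r = i\<close>.\<close>

lemma no_intercalate_rows_ij:
  assumes ic: "is_intercalate L' i j c d" and mem': "c \<in> {1..n}" "d \<in> {1..n}" "c = v"
  shows False
proof -
  have "d \<noteq> y"
    using intercalate_rows_ij[OF is_intercalate_col_commute[OF ic] mem'(2,1)] mem'(3) distinct by auto
  moreover have "d \<noteq> v" using ic mem'(3) by (auto simp: is_intercalate_def)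
  ultimately have d: "L (j, d) = L (i, v)" and q: "L' (i, d) = L (j, y)"
    using ic mem'(3) switch_entries(2,5,6) distinct unfolding is_intercalate_def by metis+
  have "d \<noteq> w" using q switch_entries(4) col_inj[OF _ i j mem(2)] ij by metis
  then have "L (i, d) = L (j, y)" using q \<open>d \<noteq> y\<close> switch_entries(6) by metis
  moreover have "col j (L (i, v)) = d" by (rule col_eqI[OF d j mem'(2)])
  ultimately show False using avoid_v[OF i] by auto
qed

text \<open>A changed cell lies in row \<open>j\<close> and column \<open>y\<close> or
  \<open>v\<close>, or in row \<open>i\<close> and column \<open>y\<close> or \<open>w\<close>. The
  second case is the first one with \<open>i\<close> and \<open>j\<close> exchanged.\<close>

lemma intercalate_switchD_col:
  assumes ic: "is_intercalate L' r s c d"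
    and mem': "c \<in> {1..n}" "d \<in> {1..n}" "r \<in> {1..k}" "s \<in> {1..k}"
    and c: "L' (r, c) \<noteq> L (r, c)"
  shows "{r, s} = {i, j} \<and> {c, d} = {x, y}"
proof -
  interpret S: switching k n L j i x y by (rule sym)
  consider "r = j" "c = y \<or> c = v" | "r = i" "c = y \<or> c = w"
    using c switch_entries(5-7) by metis
  then show ?thesis
  proof cases
    case 1
    then have s: "s = i"
      using no_intercalate_row_j ic mem' by metis
    then have ic': "is_intercalate L' i j c d"
      using ic 1 is_intercalate_row_commute by metis
    then show ?thesis
      using 1 s intercalate_rows_ij[OF ic' mem'(1,2)] no_intercalate_rows_ij[OF ic' mem'(1,2)]
      by blast
  next
    case 2
    then have s: "s = j"
      using S.no_intercalate_row_j ic mem' sym_switch by metis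
    then have ic': "is_intercalate S.L' j i c d"
      using ic 2 is_intercalate_row_commute sym_switch by metis
    then show ?thesis
      using 2 s S.intercalate_rows_ij[OF ic' mem'(1,2)] S.no_intercalate_rows_ij[OF ic' mem'(1,2)]
      by blast
  qed
qed

text \<open>By symmetry the previous lemma applies to each of the four cells; if none of them
  changed, the intercalate was already in \<open>L\<close>.\<close>

lemma intercalate_switchD:
  assumes ic: "is_intercalate L' r s c d"
    and mem': "c \<in> {1..n}" "d \<in> {1..n}" "r \<in> {1..k}" "s \<in> {1..k}"
  shows "is_intercalate L r s c d \<or> {r, s} = {i, j} \<and> {c, d} = {x, y}"
proof (rule ccontr)
  assume *: "\<not> ?thesis"
  have "L' (r, c) = L (r, c)"
    using intercalate_switchD_col[OF ic mem'] * by blast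
  moreover have "L' (r, d) = L (r, d)"
    using intercalate_switchD_col[OF is_intercalate_col_commute[OF ic] mem'(2,1,3,4)] * by blast
  moreover have "L' (s, c) = L (s, c)"
    using intercalate_switchD_col[OF is_intercalate_row_commute[OF ic] mem'(1,2,4,3)] * by blast
  moreover have "L' (s, d) = L (s, d)"
    using intercalate_switchD_col[OF is_intercalate_row_commute[OF is_intercalate_col_commute[OF ic]]
      mem'(2,1,4,3)] * by blast
  ultimately show False using ic * by (simp add: is_intercalate_def)
qed

lemma switch_intercalate: "is_intercalate L' i j x y"
  using ij distinct switch_entries by (simp add: is_intercalate_def)

lemma intercalates_switch:
  assumes "i < j"
  shows "intercalates k n L' = insert ((i, j), (min x y, max x y)) (intercalates k n L)"
    (is "?A = ?B")
proof
  show "?A \<subseteq> ?B"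
  proof
    fix p assume "p \<in> ?A"
    then obtain r s c d where p: "p = ((r, s), (c, d))" and rs: "r \<in> {1..k}" "s \<in> {1..k}" "r < s"
      and cd: "c \<in> {1..n}" "d \<in> {1..n}" "c < d" and ic: "is_intercalate L' r s c d"
      unfolding intercalates_altdef by blast
    from intercalate_switchD[OF ic cd(1,2) rs(1,2)] show "p \<in> ?B"
    proof
      assume "is_intercalate L r s c d"
      then show ?thesis using p rs cd unfolding intercalates_altdef by blast
    next
      assume "{r, s} = {i, j} \<and> {c, d} = {x, y}"
      then show ?thesis
        using p rs(3) cd(3) assms by (auto simp: doubleton_eq_iff min_def max_def)
    qed
  qed
  have "((i, j), (min x y, max x y)) \<in> ?A"
    using switch_intercalate is_intercalate_col_commute[OF switch_intercalate] i j mem assms distinct(1)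
    unfolding intercalates_altdef by (auto simp: min_def max_def)
  moreover have "intercalates k n L \<subseteq> ?A"
    unfolding intercalates_altdef using switch_intercalate_unchanged by blast
  ultimately show "?B \<subseteq> ?A" by blast
qed

lemma num_intercalates_switch:
  assumes "i < j"
  shows "num_intercalates k n L' = Suc (num_intercalates k n L)"
proof -
  have "((i, j), (min x y, max x y)) \<notin> intercalates k n L"
    using intercalates_touched clean unfolding min_def max_def by metis
  then show ?thesis
    using intercalates_switch[OF assms] finite_intercalates by (simp add: num_intercalates_def)
qed

end

section \<open>Double counting of switches between consecutive layers\<close>

lemma row_switch_inject [simp]: "row_switch i j y v w L = row_switch i j y v w K \<longleftrightarrow> L = K"
  using row_switch_involutory by metis

definition layer :: "nat \<Rightarrow> nat \<Rightarrow> nat \<Rightarrow> (nat \<times> nat \<Rightarrow> nat) set" where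
  "layer k n t = {L \<in> latin_rectangles k n. num_intercalates k n L = t}"

lemma finite_layer: "finite (layer k n t)"
  using finite_latin_rectangles by (simp add: layer_def)

lemma card_row_pairs: "2 * card (SIGMA j:{1..k}. {1..<j}) = k * (k - 1)"
proof -
  have "2 * (\<Sum>j=1..k. j - 1) = k * (k - 1)"
    by (induction k) (auto simp: algebra_simps)
  then show ?thesis by simp
qed

definition switches :: "nat \<Rightarrow> nat \<Rightarrow> (nat \<times> nat \<Rightarrow> nat) \<Rightarrow> ((nat \<times> nat) \<times> (nat \<times> nat)) set" where
  "switches k n L = (SIGMA (j, i):(SIGMA j:{1..k}. {1..<j}).
     {(x, y). latin_rectangle.switchable k n L i j x y})"

text \<open>Data from which a switch can be undone: the truth value restores the order of
  \<open>x\<close> and \<open>y\<close> lost by \<open>min\<close> and \<open>max\<close>, and then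
  all arguments of the involution \<open>row_switch\<close> are known.\<close>

definition record_switch ::
    "nat \<Rightarrow> (nat \<times> nat \<Rightarrow> nat) \<times> ((nat \<times> nat) \<times> (nat \<times> nat)) \<Rightarrow>
      (nat \<times> nat \<Rightarrow> nat) \<times> ((nat \<times> nat) \<times> (nat \<times> nat)) \<times> bool \<times> nat \<times> nat" where
  "record_switch n = (\<lambda>(L, (j, i), (x, y)).
     let v = latin_rectangle.partner n L i j x; w = latin_rectangle.partner n L j i x
     in (row_switch i j y v w L, ((i, j), (min x y, max x y)), x < y, v, w))"

lemma inj_on_record_switch: "inj_on (record_switch n) (Sigma (layer k n t) (switches k n))"
  and record_switch_image: "record_switch n ` Sigma (layer k n t) (switches k n) \<subseteq>
      (SIGMA L:layer k n (Suc t). intercalates k n L \<times> (UNIV :: bool set) \<times> {1..n} \<times> {1..n})"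
proof -
  show "inj_on (record_switch n) (Sigma (layer k n t) (switches k n))"
  proof (rule inj_onI)
    fix p q assume pq: "p \<in> Sigma (layer k n t) (switches k n)" "q \<in> Sigma (layer k n t) (switches k n)" "record_switch n p = record_switch n q"
    obtain L1 i1 j1 x1 y1 where p: "p = (L1, (j1, i1), (x1, y1))" by (metis surj_pair)
    obtain L2 i2 j2 x2 y2 where q: "q = (L2, (j2, i2), (x2, y2))" by (metis surj_pair)
    have ij: "i1 = i2" "j1 = j2" using pq(3) by (auto simp: p q record_switch_def Let_def)
    have "min x1 y1 = min x2 y2" "max x1 y1 = max x2 y2" "(x1 < y1) = (x2 < y2)"
      using pq(3) by (auto simp: p q record_switch_def Let_def)
    then have xy: "x1 = x2" "y1 = y2" by (auto simp: min_def max_def split: if_splits)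
    have "L1 = L2"
      using pq(3) by (auto simp: p q record_switch_def Let_def ij xy)
    then show "p = q" by (simp add: p q ij xy)
  qed
  show "record_switch n ` Sigma (layer k n t) (switches k n) \<subseteq>
      (SIGMA L:layer k n (Suc t). intercalates k n L \<times> (UNIV :: bool set) \<times> {1..n} \<times> {1..n})"
  proof (rule image_subsetI)
    fix p assume p: "p \<in> Sigma (layer k n t) (switches k n)"
    obtain L i j x y where p_eq: "p = (L, (j, i), (x, y))" by (metis surj_pair)
    have L: "L \<in> latin_rectangles k n" "num_intercalates k n L = t"
      and rows: "j \<in> {1..k}" "i \<in> {1..k}" "i < j"
      and sw: "latin_rectangle.switchable k n L i j x y"
      using p by (auto simp: p_eq switches_def layer_def)
    interpret switching k n L i j x y
      using L rows sw by unfold_locales auto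
    have "L' \<in> layer k n (Suc t)"
      using switch_latin num_intercalates_switch[OF rows(3)] L by (simp add: layer_def)
    moreover have "((i, j), (min x y, max x y)) \<in> intercalates k n L'"
      using intercalates_switch[OF rows(3)] by blast
    ultimately show "record_switch n p \<in>
        (SIGMA L:layer k n (Suc t). intercalates k n L \<times> (UNIV :: bool set) \<times> {1..n} \<times> {1..n})"
      using mem by (simp add: p_eq record_switch_def Let_def)
  qed
qed

text \<open>Each rectangle on the left has \<open>k * (k - 1) / 2\<close> row pairs, with the column
  pairs of \<open>card_switchable\<close>. On the right a record chooses one of \<open>Suc t\<close>
  intercalates, one of two orders, and \<open>v\<close>, \<open>w\<close> in at most
  \<open>n\<^sup>2\<close> ways. Both sides are doubled to clear the half.\<close>

lemma card_layer_Suc: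
  "card (layer k n t) * (k * (k - 1) * ((n - 6 * t) * (n - (2 * t + 8 * k)))) \<le>
   card (layer k n (Suc t)) * (Suc t * (4 * n\<^sup>2))"
proof -
  let ?P = "SIGMA j:{1..k}. {1..<j}"
  let ?N = "(n - 6 * t) * (n - (2 * t + 8 * k))"
  let ?S = "switches k n"
  let ?E = "SIGMA L:layer k n (Suc t). intercalates k n L \<times> (UNIV :: bool set) \<times> {1..n} \<times> {1..n}"
  have sw: "finite {(x, y). latin_rectangle.switchable k n L i j x y}"
    "card {(x, y). latin_rectangle.switchable k n L i j x y} \<ge> ?N"
    if "L \<in> layer k n t" "i \<in> {1..k}" "j \<in> {1..k}" for L i j
  proof -
    interpret latin_rectangle k n L using that by unfold_locales (simp add: layer_def)
    show "finite {(x, y). switchable i j x y}"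
      by (rule finite_subset[of _ "{1..n} \<times> {1..n}"]) (auto simp: switchable_def)
    show "card {(x, y). switchable i j x y} \<ge> ?N"
      using card_switchable[OF that(2,3)] that(1) by (simp add: layer_def)
  qed
  have S: "finite (?S L)" "card ?P * ?N \<le> card (?S L)" if L: "L \<in> layer k n t" for L
  proof -
    let ?T = "\<lambda>(j, i). {(x, y). latin_rectangle.switchable k n L i j x y}"
    have *: "finite (?T q)" "?N \<le> card (?T q)" if q: "q \<in> ?P" for q
    proof -
      obtain j i where "q = (j, i)" "i \<in> {1..k}" "j \<in> {1..k}" using q by force
      then show "finite (?T q)" "?N \<le> card (?T q)" using sw[OF L] by auto
    qed
    have eq: "?S L = Sigma ?P ?T" by (auto simp: switches_def)
    moreover have "finite ?P" by simp
    ultimately show "finite (?S L)" using *(1) by (auto intro!: finite_SigmaI)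
    have "card (Sigma ?P ?T) = (\<Sum>q\<in>?P. card (?T q))"
      using *(1) by (intro card_SigmaI) auto
    moreover have "(\<Sum>q\<in>?P. ?N) \<le> (\<Sum>q\<in>?P. card (?T q))" by (rule sum_mono[OF *(2)])
    ultimately show "card ?P * ?N \<le> card (?S L)" using eq by simp
  qed
  have "card (layer k n t) * (card ?P * ?N) = (\<Sum>L\<in>layer k n t. card ?P * ?N)" by simp
  also have "\<dots> \<le> (\<Sum>L\<in>layer k n t. card (?S L))" by (rule sum_mono[OF S(2)])
  also have "\<dots> = card (Sigma (layer k n t) (switches k n))"
    using S(1) finite_layer by (intro card_SigmaI[symmetric]) auto
  also have "\<dots> \<le> card ?E"
    using inj_on_record_switch[of n k t] record_switch_image[of n k t] finite_layer finite_intercalates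
    by (intro card_inj_on_le finite_SigmaI finite_cartesian_product) auto
  also have "\<dots> = (\<Sum>L\<in>layer k n (Suc t). card (intercalates k n L \<times> (UNIV :: bool set) \<times> {1..n} \<times> {1..n}))"
    using finite_layer finite_intercalates
    by (intro card_SigmaI ballI finite_cartesian_product) auto
  also have "\<dots> = (\<Sum>L\<in>layer k n (Suc t). Suc t * (2 * n\<^sup>2))"
    by (intro sum.cong) (auto simp: card_cartesian_product layer_def num_intercalates_def power2_eq_square)
  finally have "card (layer k n t) * (card ?P * ?N) \<le> card (layer k n (Suc t)) * (Suc t * (2 * n\<^sup>2))"
    by simp
  then have "card (layer k n t) * ((2 * card ?P) * ?N) \<le> card (layer k n (Suc t)) * (Suc t * (4 * n\<^sup>2))"
    by (simp add: algebra_simps)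
  then show ?thesis by (simp only: card_row_pairs)
qed

section \<open>From layer ratios to a probability bound for fixed sizes\<close>

text \<open>The ratio to the Poisson weight, \<open>a t * fact t / c ^ t\<close>, is nondecreasing
  up to \<open>M\<close>. Bounding it by its value at \<open>M\<close> leaves a partial sum of the
  exponential series.\<close>

lemma sum_le_of_ratio:
  fixes a :: "nat \<Rightarrow> real"
  assumes "c > 0" "\<And>t. a t \<ge> 0" "\<And>t. t < M \<Longrightarrow> c * a t \<le> real (Suc t) * a (Suc t)"
  shows "(\<Sum>t<M. a t) \<le> a M * (fact M / c ^ M * exp c)"
proof -
  define w where "w t = a t * fact t / c ^ t" for t
  have step: "w t \<le> w (Suc t)" if "t < M" for t
  proof -
    have "w t = c * a t * (fact t / c ^ Suc t)" using assms(1) by (simp add: w_def)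
    also have "\<dots> \<le> real (Suc t) * a (Suc t) * (fact t / c ^ Suc t)"
      using assms that by (intro mult_right_mono) auto
    also have "\<dots> = w (Suc t)" by (simp add: w_def)
    finally show ?thesis .
  qed
  have w: "w t \<le> w M" if "t \<le> M" for t
    using that by (induction rule: inc_induct) (use step order.trans in blast)+
  have "(\<Sum>t<M. a t) = (\<Sum>t<M. w t * (c ^ t / fact t))"
    using assms(1) by (intro sum.cong) (auto simp: w_def)
  also have "\<dots> \<le> (\<Sum>t<M. w M * (c ^ t / fact t))"
    using w assms(1) by (intro sum_mono mult_right_mono) auto
  also have "\<dots> = w M * (\<Sum>t<M. c ^ t /\<^sub>R fact t)"
    by (simp add: sum_distrib_left field_simps)
  also have "\<dots> \<le> w M * exp c"
  proof (rule mult_left_mono)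
    show "(\<Sum>t<M. c ^ t /\<^sub>R fact t) \<le> exp c"
      unfolding exp_def using assms(1) summable_exp_generic[of c] by (intro sum_le_suminf) auto
    show "0 \<le> w M" using assms by (simp add: w_def)
  qed
  finally show ?thesis by (simp add: w_def algebra_simps)
qed

text \<open>This is a single term of the exponential series; it yields \<open>Q \<ge> 1\<close>
  below.\<close>

lemma power_div_fact_le_exp:
  fixes c :: real
  assumes "c \<ge> 0"
  shows "c ^ M / fact M \<le> exp c"
proof -
  have "(\<Sum>t\<in>{M}. c ^ t /\<^sub>R fact t) \<le> exp c"
    unfolding exp_def using assms summable_exp_generic[of c] by (intro sum_le_suminf) auto
  then show ?thesis by (simp add: field_simps)
qed

text \<open>A weak Stirling bound, M! <= e M (M/e)^M. The induction step rests on ln u <= u - 1 at u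
  = M/(M+1).\<close>

lemma ln_fact_le:
  assumes "M > 0"
  shows "ln (fact M) \<le> (real M + 1) * ln (real M) - real M + 1"
  using assms
proof (induction M rule: nat_induct_non_zero)
  case 1
  then show ?case by simp
next
  case (Suc M)
  have "ln (real M / real (Suc M)) \<le> real M / real (Suc M) - 1"
    using Suc.hyps by (intro ln_le_minus_one) auto
  then have "ln (real M) - ln (real (Suc M)) \<le> - 1 / real (Suc M)"
    using Suc.hyps by (simp add: ln_div field_simps)
  then have "real (Suc M) * (ln (real M) - ln (real (Suc M))) \<le> real (Suc M) * (- 1 / real (Suc M))"
    by (intro mult_left_mono) auto
  then have *: "real (Suc M) * ln (real M) + 1 \<le> real (Suc M) * ln (real (Suc M))"
    by (simp add: right_diff_distrib)
  have "ln (fact (Suc M)) = ln (real (Suc M)) + ln (fact M)"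
    by (simp add: ln_mult)
  then show ?case using Suc.IH * by (simp add: algebra_simps)
qed

text \<open>Here \<open>c\<close> is the ratio from \<open>card_layer_Suc\<close> with
  \<open>t\<close> replaced by \<open>M\<close>, where the factors are smallest, so it serves for
  every \<open>t < M\<close>. The conditions on \<open>n\<close> keep the factors positive, make the
  natural subtractions exact and give \<open>k \<le> n\<close>.\<close>

lemma prob_many_intercalates_ge:
  fixes k n M :: nat
  defines "c \<equiv> (real k)\<^sup>2 / 4 * (1 - 1 / real k) * (1 - 6 * real M / real n) *
    (1 - (2 * real M + 8 * real k) / real n)"
  assumes k: "k \<ge> 2" and M: "M > 0" and n: "6 * M < n" "2 * M + 8 * k < n"
  shows "c > 0"
    and "measure_pmf.prob (random_latin_rectangle k n) {L. M \<le> num_intercalates k n L} \<ge>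
      exp (- (ln 2 + (real M + 1) * ln (real M) - real M + 1 - real M * ln c + c))"
proof -
  have pos: "1 - 6 * real M / real n > 0" "1 - (2 * real M + 8 * real k) / real n > 0"
    "1 - 1 / real k > 0"
    using k n by (auto simp: field_simps)
  then show c: "c > 0" using k by (simp add: c_def)
  let ?R = "latin_rectangles k n" and ?a = "\<lambda>t. real (card (layer k n t))"
  define B where "B = {L \<in> ?R. M \<le> num_intercalates k n L}"
  define Q where "Q = fact M / c ^ M * exp c"
  have fin: "finite ?R" and ne: "?R \<noteq> {}"
    using finite_latin_rectangles latin_rectangles_nonempty n by auto
  have "c * ?a t \<le> real (Suc t) * ?a (Suc t)" if t: "t < M" for t
  proof -
    have n0: "real n > 0" using n by auto
    have "c * ?a t \<le> ((real k)\<^sup>2 / 4 * (1 - 1 / real k) * (1 - 6 * real t / real n) *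
        (1 - (2 * real t + 8 * real k) / real n)) * ?a t"
      unfolding c_def using pos t n0
      by (intro mult_right_mono mult_mono mult_nonneg_nonneg diff_mono divide_right_mono add_mono) auto
    also have "\<dots> = ?a t * (real k * (real k - 1) * ((real n - 6 * real t) *
        (real n - (2 * real t + 8 * real k)))) / (4 * (real n)\<^sup>2)"
      using n0 k by (simp add: field_simps power2_eq_square)
    also have "\<dots> = real (card (layer k n t) *
        (k * (k - 1) * ((n - 6 * t) * (n - (2 * t + 8 * k))))) / (4 * (real n)\<^sup>2)"
      using k n t by (simp add: of_nat_diff)
    also have "\<dots> \<le> real (card (layer k n (Suc t)) * (Suc t * (4 * n\<^sup>2))) / (4 * (real n)\<^sup>2)"
      by (intro divide_right_mono of_nat_mono card_layer_Suc) auto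
    also have "\<dots> = real (Suc t) * ?a (Suc t)"
      using n0 by (simp add: field_simps)
    finally show ?thesis .
  qed
  then have sum: "(\<Sum>t<M. ?a t) \<le> ?a M * Q"
    unfolding Q_def using c by (intro sum_le_of_ratio) auto
  have Q: "Q \<ge> 1"
    using power_div_fact_le_exp[of c M] c by (simp add: Q_def field_simps)
  \<comment> \<open>The rectangles outside \<open>B\<close> lie in layers below \<open>M\<close> and
    number at most \<open>?a M * Q\<close>, hence at most \<open>card B * Q\<close>. As
    \<open>Q \<ge> 1\<close>, all of \<open>?R\<close> has at most \<open>2 * Q * card B\<close>
    elements.\<close>
  have "?R = B \<union> (\<Union>t<M. layer k n t)" by (auto simp: B_def layer_def)
  then have "card ?R \<le> card B + card (\<Union>t<M. layer k n t)" by (metis card_Un_le)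
  moreover have "card (\<Union>t<M. layer k n t) \<le> (\<Sum>t<M. card (layer k n t))"
    by (rule card_UN_le) simp
  ultimately have "card ?R \<le> card B + (\<Sum>t<M. card (layer k n t))" by linarith
  then have "real (card ?R) \<le> real (card B) + (\<Sum>t<M. ?a t)"
    by (simp flip: of_nat_sum of_nat_add)
  moreover have "?a M * Q \<le> real (card B) * Q"
    using fin Q by (intro mult_right_mono of_nat_mono card_mono) (auto simp: B_def layer_def)
  moreover have "real (card B) * 1 \<le> real (card B) * Q"
    using Q by (intro mult_left_mono) auto
  ultimately have "real (card ?R) \<le> 2 * Q * real (card B)"
    using sum by (simp add: algebra_simps)
  moreover have "card ?R > 0" using fin ne by (simp add: card_gt_0_iff)
  ultimately have "1 / (2 * Q) \<le> real (card B) / real (card ?R)"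
    using Q by (simp add: field_simps)
  also have "\<dots> = measure_pmf.prob (random_latin_rectangle k n) {L. M \<le> num_intercalates k n L}"
    unfolding random_latin_rectangle_def measure_pmf_of_set[OF ne fin] B_def
    by (simp add: Int_def)
  finally have prob: "1 / (2 * Q) \<le>
    measure_pmf.prob (random_latin_rectangle k n) {L. M \<le> num_intercalates k n L}" .
  have "ln (2 * Q) = ln 2 + (ln (fact M) - real M * ln c + c)"
    using c by (simp add: Q_def ln_mult ln_div ln_realpow)
  then have "ln (2 * Q) \<le> ln 2 + (real M + 1) * ln (real M) - real M + 1 - real M * ln c + c"
    using ln_fact_le[OF M] by simp
  then have "exp (- (ln 2 + (real M + 1) * ln (real M) - real M + 1 - real M * ln c + c)) \<le>
      exp (- ln (2 * Q))"
    by simp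
  also have "\<dots> = 1 / (2 * Q)" using Q by (simp add: exp_minus inverse_eq_divide)
  finally show "exp (- (ln 2 + (real M + 1) * ln (real M) - real M + 1 - real M * ln c + c)) \<le>
    measure_pmf.prob (random_latin_rectangle k n) {L. M \<le> num_intercalates k n L}"
    using prob by linarith
qed


section \<open>Asymptotics of the bound\<close>

theorem theorem6p1:
  fixes \<delta> :: real and k :: "nat \<Rightarrow> nat"
  assumes "\<delta> > 0"
    and "\<exists>e :: nat \<Rightarrow> real. e \<in> o(\<lambda>_. 1) \<and>
           (\<forall>\<^sub>F n in sequentially. real (k n) = real n powr e n)"
    and "(\<lambda>n. real (k n)) \<in> \<omega>(\<lambda>_. 1)"
  shows "\<exists>\<epsilon> :: nat \<Rightarrow> real. \<epsilon> \<in> o(\<lambda>_. 1) \<and>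
           (\<forall>\<^sub>F n in sequentially.
              measure_pmf.prob (random_latin_rectangle (k n) n)
                {L. real (num_intercalates (k n) n L) \<ge> (1 + \<delta>) * ((real (k n))\<^sup>2 / 4)}
              \<ge> exp ((\<delta> - (1 + \<delta>) * ln (1 + \<delta>) - \<epsilon> n) * ((real (k n))\<^sup>2 / 4)))"
proof -
  define l where "l n = (real (k n))\<^sup>2 / 4" for n
  \<comment> \<open>With the ceiling, \<open>M n \<le> N\<close> for a natural number
    \<open>N\<close> is equivalent to the real threshold.\<close>
  define M where "M n = nat \<lceil>(1 + \<delta>) * l n\<rceil>" for n
  define h where "h n = (1 - 1 / real (k n)) * (1 - 6 * real (M n) / real n) *
    (1 - (2 * real (M n) + 8 * real (k n)) / real n)" for n
  define m where "m n = real (M n) / l n" for n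
  \<comment> \<open>Chosen so that the exponent of \<open>prob_many_intercalates_ge\<close>, where
    \<open>c = l n * h n\<close>, equals the claimed one exactly. The Stirling loss ln M, divided by
    \<open>l n\<close>, is written as (ln M / M) times \<open>m n\<close> so that its limit 0 is
    visible.\<close>
  define \<epsilon> where "\<epsilon> n = (ln 2 + 1) / l n + ln (real (M n)) / real (M n) * m n +
    m n * ln (m n / h n) - m n + h n + \<delta> - (1 + \<delta>) * ln (1 + \<delta>)" for n
  have k_inf: "filterlim (\<lambda>n. real (k n)) at_top sequentially"
    using smallomegaD_filterlim_at_top_norm[OF assms(3)] by simp
  have l_inf: "filterlim l at_top sequentially"
    unfolding l_def using k_inf
    by (intro filterlim_tendsto_pos_mult_at_top[where c = "1/4" and f = "\<lambda>_. 1/4", simplified])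
      (auto intro!: filterlim_pow_at_top)
  have l_pos: "\<forall>\<^sub>F n in sequentially. l n > 0"
    using l_inf by (simp add: filterlim_at_top_dense)
  have l_n: "(\<lambda>n. l n / real n) \<longlonglongrightarrow> 0"
  proof (rule real_tendsto_sandwich[where f = "\<lambda>_. 0" and h = "\<lambda>n. real n powr (- 1 / 2)"])
    obtain e :: "nat \<Rightarrow> real" where e: "e \<in> o(\<lambda>_. 1)"
      "\<forall>\<^sub>F n in sequentially. real (k n) = real n powr e n"
      using assms(2) by blast
    have "e \<longlonglongrightarrow> 0" using smalloD_tendsto[OF e(1)] by simp
    \<comment> \<open>The bound 1/4 makes \<open>(k n)\<^sup>2\<close> at most the square root of
      \<open>n\<close>, so \<open>l n / n\<close> tends to 0.\<close>
    then have "\<forall>\<^sub>F n in sequentially. e n < 1 / 4" by (rule order_tendstoD) simp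
    then show "\<forall>\<^sub>F n in sequentially. l n / real n \<le> real n powr (- 1 / 2)"
      using e(2) eventually_gt_at_top[of 0]
    proof eventually_elim
      case (elim n)
      have "l n \<le> (real (k n))\<^sup>2" by (simp add: l_def)
      also have "\<dots> \<le> (real n powr (1 / 4))\<^sup>2"
        using elim by (intro power_mono) (auto intro!: powr_mono)
      also have "\<dots> = real n powr (1 / 2)" by (simp add: power2_eq_square flip: powr_add)
      finally have "l n / real n \<le> real n powr (1 / 2) / real n powr 1"
        using elim by (simp add: divide_right_mono)
      also have "\<dots> = real n powr (1 / 2 - 1)" by (rule powr_diff[symmetric])
      finally show ?case by simp
    qed
    show "(\<lambda>n. real n powr (- 1 / 2)) \<longlonglongrightarrow> 0"
      by (rule tendsto_neg_powr) (auto simp: filterlim_real_sequentially)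
  qed (auto simp: l_def)
  have m: "m \<longlonglongrightarrow> 1 + \<delta>"
  proof (rule real_tendsto_sandwich[where f = "\<lambda>_. 1 + \<delta>"])
    show "\<forall>\<^sub>F n in sequentially. 1 + \<delta> \<le> m n"
      using l_pos
    proof eventually_elim
      case (elim n)
      have "(1 + \<delta>) * l n \<le> real (M n)" unfolding M_def by (rule of_nat_ceiling)
      then show ?case using elim by (simp add: m_def field_simps)
    qed
    show "\<forall>\<^sub>F n in sequentially. m n \<le> 1 + \<delta> + 1 / l n"
      using l_pos
    proof eventually_elim
      case (elim n)
      have "real (M n) \<le> (1 + \<delta>) * l n + 1"
        unfolding M_def using elim assms(1) by (simp add: of_nat_nat)
      then show ?case using elim by (simp add: m_def field_simps)
    qed
    have "(\<lambda>n. 1 / l n) \<longlonglongrightarrow> 0"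
      using tendsto_inverse_0_at_top[OF l_inf] by (simp add: inverse_eq_divide)
    then show "(\<lambda>n. 1 + \<delta> + 1 / l n) \<longlonglongrightarrow> 1 + \<delta>"
      using tendsto_add[OF tendsto_const] by fastforce
  qed auto
  have M_eq: "\<forall>\<^sub>F n in sequentially. real (M n) = m n * l n"
    using l_pos by eventually_elim (simp add: m_def)
  have M_inf: "filterlim (\<lambda>n. real (M n)) at_top sequentially"
    using filterlim_tendsto_pos_mult_at_top[OF m _ l_inf] assms(1) filterlim_cong[OF refl refl M_eq]
    by simp
  have M_n: "(\<lambda>n. real (M n) / real n) \<longlonglongrightarrow> 0"
  proof (rule Lim_transform_eventually)
    show "(\<lambda>n. m n * (l n / real n)) \<longlonglongrightarrow> 0" using tendsto_mult[OF m l_n] by simp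
    show "\<forall>\<^sub>F n in sequentially. m n * (l n / real n) = real (M n) / real n"
      using M_eq by eventually_elim simp
  qed
  have inv_k: "(\<lambda>n. 1 / real (k n)) \<longlonglongrightarrow> 0"
    using tendsto_inverse_0_at_top[OF k_inf] by (simp add: inverse_eq_divide)
  have k_n: "(\<lambda>n. real (k n) / real n) \<longlonglongrightarrow> 0"
  proof (rule Lim_transform_eventually)
    \<comment> \<open>k/n is rewritten as (4/k)(l/n), a product of two null sequences.\<close>
    show "(\<lambda>n. 4 * (1 / real (k n)) * (l n / real n)) \<longlonglongrightarrow> 0"
      using tendsto_mult[OF tendsto_mult[OF tendsto_const inv_k] l_n] by simp
    show "\<forall>\<^sub>F n in sequentially. 4 * (1 / real (k n)) * (l n / real n) = real (k n) / real n"
      using l_pos by eventually_elim (simp add: l_def power2_eq_square)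
  qed
  have M_k_n: "(\<lambda>n. (2 * real (M n) + 8 * real (k n)) / real n) \<longlonglongrightarrow> 0"
    using tendsto_add[OF tendsto_mult_left[OF M_n, of 2] tendsto_mult_left[OF k_n, of 8]]
    by (simp add: add_divide_distrib)
  have M_6_n: "(\<lambda>n. 6 * real (M n) / real n) \<longlonglongrightarrow> 0"
    using tendsto_mult_left[OF M_n, of 6] by simp
  have h: "h \<longlonglongrightarrow> 1"
    unfolding h_def by (rule tendsto_eq_intros inv_k M_6_n M_k_n refl | simp)+
  have "\<epsilon> \<longlonglongrightarrow> 0 + 0 * (1 + \<delta>) + (1 + \<delta>) * ln ((1 + \<delta>) / 1) - (1 + \<delta>) + 1 + \<delta> - (1 + \<delta>) * ln (1 + \<delta>)"
    unfolding \<epsilon>_def using assms(1)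
    by (intro tendsto_intros m h filterlim_compose[OF ln_x_over_x_tendsto_0 M_inf]
      tendsto_divide_0[OF tendsto_const filterlim_at_top_imp_at_infinity[OF l_inf]]) auto
  then have "\<epsilon> \<longlonglongrightarrow> 0" by simp
  then have "\<epsilon> \<in> o(\<lambda>_. 1)" by (intro smalloI_tendsto) auto
  moreover have "\<forall>\<^sub>F n in sequentially.
      measure_pmf.prob (random_latin_rectangle (k n) n)
        {L. real (num_intercalates (k n) n L) \<ge> (1 + \<delta>) * ((real (k n))\<^sup>2 / 4)}
      \<ge> exp ((\<delta> - (1 + \<delta>) * ln (1 + \<delta>) - \<epsilon> n) * ((real (k n))\<^sup>2 / 4))"
    using l_pos eventually_gt_at_top[of 0] order_tendstoD(2)[OF M_6_n zero_less_one]
      order_tendstoD(2)[OF M_k_n zero_less_one]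
      k_inf[unfolded filterlim_at_top, rule_format, of 2]
      M_inf[unfolded filterlim_at_top, rule_format, of 1]
  proof eventually_elim
    case (elim n)
    have n: "6 * M n < n" "2 * M n + 8 * k n < n"
      using elim(2-4) by (auto simp: divide_less_eq_1)
    have k: "k n \<ge> 2" and M: "M n > 0" using elim by auto
    note prob = prob_many_intercalates_ge[OF k M n]
    have c_eq: "(real (k n))\<^sup>2 / 4 * (1 - 1 / real (k n)) * (1 - 6 * real (M n) / real n) *
        (1 - (2 * real (M n) + 8 * real (k n)) / real n) = l n * h n"
      by (simp add: l_def h_def)
    have h0: "h n > 0" using prob(1) elim(1) unfolding c_eq by (simp add: zero_less_mult_iff)
    have m0: "m n > 0" using M elim(1) by (simp add: m_def)
    \<comment> \<open>Since M = m l, the difference ln M - ln (l h) is ln (m/h); this removes the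
      growing logarithm from the main term.\<close>
    have "(real (M n) + 1) * ln (real (M n)) - real (M n) * ln (l n * h n) =
        ln (real (M n)) + real (M n) * ln (m n / h n)"
      using elim(1) h0 M by (simp add: m_def ln_div ln_mult algebra_simps)
    moreover have "\<epsilon> n * l n = ln 2 + 1 + ln (real (M n)) + real (M n) * ln (m n / h n) - real (M n) +
        l n * h n + (\<delta> - (1 + \<delta>) * ln (1 + \<delta>)) * l n"
    proof -
      have "m n * l n = real (M n)" using elim(1) by (simp add: m_def)
      moreover have "ln (real (M n)) / real (M n) * m n * l n = ln (real (M n))"
        using elim(1) M by (simp add: m_def)
      moreover have "(ln 2 + 1) / l n * l n = ln 2 + 1" using elim(1) by simp
      moreover have "\<epsilon> n * l n = (ln 2 + 1) / l n * l n + ln (real (M n)) / real (M n) * m n * l n +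
        (m n * l n) * ln (m n / h n) - m n * l n + l n * h n + (\<delta> - (1 + \<delta>) * ln (1 + \<delta>)) * l n"
        by (simp add: \<epsilon>_def algebra_simps)
      ultimately show ?thesis by simp
    qed
    ultimately have "(\<delta> - (1 + \<delta>) * ln (1 + \<delta>) - \<epsilon> n) * l n =
        - (ln 2 + (real (M n) + 1) * ln (real (M n)) - real (M n) + 1 - real (M n) * ln (l n * h n) + l n * h n)"
      by (simp add: left_diff_distrib)
    moreover have "{L. M n \<le> num_intercalates (k n) n L} =
        {L. real (num_intercalates (k n) n L) \<ge> (1 + \<delta>) * l n}"
      by (auto simp: M_def nat_le_iff ceiling_le_iff)
    ultimately show ?case
      using prob(2)[unfolded c_eq] unfolding l_def[symmetric] by (simp only:)
  qed
  ultimately show ?thesis by blast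
qed

end
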